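(* Let $k\ge 2$ be an integer, and let $S_k^-=\{1,2,\ldots,k-2,k\}$ (so $S_2^-=\{2\}$). For every positive integer $n\ge k-1$, $$r_o^{S_k^-}(n) > r_e^{S_k^-}(n)\ \text{ if } k \text{ is even},\qquad r_e^{S_k^-}(n) > r_o^{S_k^-}(n)\ \text{ if } k \text{ is odd}.$$ For all other positive integers $n$ (that is, $n\le k-2$), $r_o^{S_k^-}(n)=r_e^{S_k^-}(n)$.
   Context: A partition is a finite, nonempty, nonincreasing sequence of positive integers called its parts. The perimeter of a partition $\pi$ is $\alpha_\pi+\lambda_\pi-1$, where $\alpha_\pi$ is the largest part of $\pi$ and $\lambda_\pi$ is the number of parts of $\pi$ (counted with multiplicity). For a set $S$ of positive integers, $r_o^S(n)$ (respectively $r_e^S(n)$) is the number of partitions of perimeter $n$ with no parts from $S$ and with more odd than even parts (respectively more even than odd parts), parts being counted with multiplicity. *)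

theory Defs
  imports Main
begin

definition is_partition :: "nat list \<Rightarrow> bool" where
  "is_partition p \<longleftrightarrow> p \<noteq> [] \<and> sorted_wrt (\<ge>) p \<and> (\<forall>x\<in>set p. 0 < x)"

definition perimeter :: "nat list \<Rightarrow> nat" where
  "perimeter p = Max (set p) + length p - 1"

definition odd_parts :: "nat list \<Rightarrow> nat" where
  "odd_parts p = length (filter odd p)"

definition even_parts :: "nat list \<Rightarrow> nat" where
  "even_parts p = length (filter even p)"

definition perimeter_partitions :: "nat set \<Rightarrow> nat \<Rightarrow> nat list set" where
  "perimeter_partitions S n = {p. is_partition p \<and> perimeter p = n \<and> set p \<inter> S = {}}"

text \<open>Finiteness, so that the cardinalities below are genuine counts.\<close>

lemma finite_perimeter_partitions: "finite (perimeter_partitions S n)"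
proof (rule finite_subset)
  show "perimeter_partitions S n \<subseteq> {p. set p \<subseteq> {..n} \<and> length p \<le> n}"
  proof
    fix p assume "p \<in> perimeter_partitions S n"
    then have p: "p \<noteq> []" "\<forall>x\<in>set p. 0 < x" "Max (set p) + length p - 1 = n"
      by (auto simp: perimeter_partitions_def is_partition_def perimeter_def)
    have len: "0 < length p" using p(1) by simp
    have "Max (set p) \<in> set p" using p(1) by simp
    then have pos: "0 < Max (set p)" using p(2) by blast
    have "x \<le> n" if "x \<in> set p" for x
    proof -
      have "x \<le> Max (set p)" using that by simp
      then show ?thesis using p(3) len by linarith
    qed
    moreover have "length p \<le> n" using p(3) pos by linarith
    ultimately show "p \<in> {p. set p \<subseteq> {..n} \<and> length p \<le> n}" by auto
  qed
  show "finite {p. set p \<subseteq> {..n} \<and> length p \<le> n}"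
    by (rule finite_lists_length_le) simp
qed

definition r_odd :: "nat set \<Rightarrow> nat \<Rightarrow> nat" where
  "r_odd S n = card {p \<in> perimeter_partitions S n. odd_parts p > even_parts p}"

definition r_even :: "nat set \<Rightarrow> nat \<Rightarrow> nat" where
  "r_even S n = card {p \<in> perimeter_partitions S n. even_parts p > odd_parts p}"

text \<open>The set \<open>{1, 2, \<dots>, k-2, k}\<close>, intended for \<open>k \<ge> 2\<close>; the interval is empty when \<open>k = 2\<close>.\<close>

definition S_minus :: "nat \<Rightarrow> nat set" where
  "S_minus k = {1..k - 2} \<union> {k}"

end

theory Submission
  imports Defs
begin

text \<open>
  The allowed parts are \<open>k - 1\<close> and everything above \<open>k\<close>. The claim is that the parts with the
  parity of \<open>k - 1\<close> win: more partitions have a majority of such parts than a majority of the others.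
  Weigh each part by \<open>1\<close> if it has the parity of \<open>k - 1\<close> and by \<open>-1\<close> otherwise. The weight of a
  partition is called its surplus, and the partitions of positive surplus have to outnumber those of
  negative surplus.

  Let \<open>r\<close> be a nonempty nonincreasing list of parts above \<open>k\<close>, let \<open>z\<close> consist of copies of
  \<open>k - 1\<close>, and compare the two partitions
  \<open>r @ (k + 1) # z\<close> and \<open>map Suc r @ z\<close>.
  They have the same perimeter, since the second has one part less and a largest part greater by one.
  (On the boundary path of the Young diagram this exchanges one vertical step for a horizontal one.)
  Raising every part of \<open>r\<close> by one reverses all parities, so the surpluses are \<open>s + 1 + a\<close> and
  \<open>-s + a\<close>, where \<open>s\<close> is the surplus of \<open>r\<close> and \<open>a\<close> the length of \<open>z\<close>. Their sum \<open>1 + 2 * a\<close> is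
  positive, so if one of the two surpluses is negative then the other is positive.

  A partition of negative surplus always occurs in such a pair: a partition outside all pairs has only
  parts \<open>k - 1\<close> and at most one part \<open>k + 1\<close>, all of weight \<open>1\<close>. Hence exchanging the two members
  of a pair (\<open>toggle\<close>) embeds the partitions of negative surplus into those of positive surplus. The
  partition with all parts equal to \<open>k - 1\<close> has positive surplus and is in no pair; it exists as soon
  as \<open>n \<ge> k - 1\<close> and makes the inequality strict. For smaller \<open>n\<close> there is no partition to count.
\<close>

section \<open>Surplus, allowed parts and perimeter\<close>

definition surplus :: "nat \<Rightarrow> nat list \<Rightarrow> int" where
  "surplus k p = (\<Sum>x\<leftarrow>p. (-1) ^ (x + k + 1))"

lemma surplus_append [simp]: "surplus k (p @ q) = surplus k p + surplus k q"
  by (simp add: surplus_def)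

lemma surplus_Cons [simp]: "surplus k (x # p) = (-1) ^ (x + k + 1) + surplus k p"
  by (simp add: surplus_def)

lemma surplus_Nil [simp]: "surplus k [] = 0"
  by (simp add: surplus_def)

lemma surplus_map_Suc [simp]: "surplus k (map Suc p) = - surplus k p"
  by (induction p) auto

lemma surplus_eq: "surplus k p = (-1) ^ k * (int (odd_parts p) - int (even_parts p))"
  by (induction p) (auto simp: odd_parts_def even_parts_def power_add algebra_simps)

lemma surplus_smallest_parts:
  assumes "k \<ge> 2" and "set z \<subseteq> {k - 1}"
  shows "surplus k z = int (length z)"
  using assms(2)
proof (induction z)
  case (Cons x z)
  then have "x + k + 1 = 2 * k"
    using assms(1) by auto
  with Cons show ?case
    by simp
qed simp

lemma notin_S_minus_iff:
  assumes "k \<ge> 2" and "x > 0"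
  shows "x \<notin> S_minus k \<longleftrightarrow> x = k - 1 \<or> k < x"
  using assms by (auto simp: S_minus_def)

lemma sorted_wrt_ge_eq_filter_append:
  fixes p :: "nat list"
  assumes "sorted_wrt (\<ge>) p"
  shows "p = filter (\<lambda>x. c < x) p @ filter (\<lambda>x. x \<le> c) p"
  using assms
proof (induction p)
  case (Cons x p)
  show ?case
  proof (cases "c < x")
    case True
    with Cons show ?thesis by simp
  next
    case False
    with Cons.prems have "\<forall>y\<in>set (x # p). y \<le> c"
      by force
    then have "filter (\<lambda>y. c < y) (x # p) = []" "filter (\<lambda>y. y \<le> c) (x # p) = x # p"
      by (auto simp: filter_empty_conv filter_id_conv simp del: filter.simps)
    then show ?thesis by simp
  qed
qed simp

lemma perimeter_eq_hd:
  assumes "sorted_wrt (\<ge>) p" and "p \<noteq> []"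
  shows "perimeter p = hd p + length p - 1"
proof -
  have "Max (set p) = hd p"
    using assms by (cases p) (auto intro!: Max_eqI)
  then show ?thesis
    by (simp add: perimeter_def)
qed

section \<open>Exchanging the two members of a pair\<close>

text \<open>Parts of size \<open>k\<close> never occur, so the filters below cut a partition into its parts above
  \<open>k\<close> and its parts \<open>k - 1\<close>. A part \<open>k + 1\<close>, if there is one, is the last of the former.\<close>

definition toggle :: "nat \<Rightarrow> nat list \<Rightarrow> nat list" where
  "toggle k p =
    (let q = filter (\<lambda>x. k < x) p; z = filter (\<lambda>x. x < k) p
     in if k + 1 \<in> set q then map Suc (butlast q) @ z
        else map (\<lambda>x. x - 1) q @ (k + 1) # z)"

context
  fixes k :: nat and r z :: "nat list"
  assumes k: "k \<ge> 2" and r: "r \<noteq> []" "\<forall>x\<in>set r. k < x" and z: "set z \<subseteq> {k - 1}"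
begin

lemma z_filters: "filter (\<lambda>x. k < x) z = []" "filter (\<lambda>x. x < k) z = z"
  using k z by (auto simp: filter_empty_conv filter_id_conv)

lemma r_filters: "filter (\<lambda>x. k < x) r = r" "filter (\<lambda>x. x < k) r = []"
  using r by (force simp: filter_empty_conv filter_id_conv)+

lemma map_Suc_r_filters:
  "filter (\<lambda>x. k < x) (map Suc r) = map Suc r" "filter (\<lambda>x. x < k) (map Suc r) = []"
  using r by (force simp: filter_empty_conv filter_id_conv)+

lemma toggle_with_Suc_k: "toggle k (r @ (k + 1) # z) = map Suc r @ z"
  by (simp add: toggle_def z_filters r_filters butlast_append)

lemma toggle_without_Suc_k: "toggle k (map Suc r @ z) = r @ (k + 1) # z"
proof -
  have "k + 1 \<notin> set (map Suc r)"
    using r by auto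
  then show ?thesis
    by (simp add: toggle_def z_filters map_Suc_r_filters comp_def del: filter_map set_map)
qed

lemma perimeter_partitions_pair:
  "r @ (k + 1) # z \<in> perimeter_partitions (S_minus k) n \<longleftrightarrow>
   map Suc r @ z \<in> perimeter_partitions (S_minus k) n" (is "?X \<in> _ \<longleftrightarrow> ?Y \<in> _")
proof -
  have large: "x \<notin> S_minus k" if "k < x" for x
    using that k notin_S_minus_iff[of k x] by auto
  have "k - 1 \<notin> S_minus k"
    using k notin_S_minus_iff[of k "k - 1"] by auto
  with z have "set z \<inter> S_minus k = {}"
    by auto
  with r large have S: "set ?X \<inter> S_minus k = {}" "set ?Y \<inter> S_minus k = {}"
    by auto
  have pos: "\<forall>x\<in>set ?X. 0 < x" "\<forall>x\<in>set ?Y. 0 < x"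
    using k r z by auto
  have z_less: "y < k" if "y \<in> set z" for y
    using that z k by auto
  have sorted_X: "sorted_wrt (\<ge>) ?X \<longleftrightarrow> sorted_wrt (\<ge>) r \<and> sorted_wrt (\<ge>) z"
    using r z_less by (force simp: sorted_wrt_append)
  have sorted_Y: "sorted_wrt (\<ge>) ?Y \<longleftrightarrow> sorted_wrt (\<ge>) r \<and> sorted_wrt (\<ge>) z"
    using r z_less by (force simp: sorted_wrt_append sorted_wrt_map)
  have "perimeter ?X = perimeter ?Y" if "sorted_wrt (\<ge>) r \<and> sorted_wrt (\<ge>) z"
    using that sorted_X sorted_Y r by (simp add: perimeter_eq_hd hd_map)
  with S pos sorted_X sorted_Y r show ?thesis
    by (auto simp: perimeter_partitions_def is_partition_def)
qed

text \<open>The parts of \<open>r\<close> cancel; what remains is \<open>1\<close> for the part \<open>k + 1\<close> and twice the length of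
  \<open>z\<close>.\<close>

lemma surplus_pair_pos: "surplus k (r @ (k + 1) # z) + surplus k (map Suc r @ z) > 0"
  using surplus_smallest_parts[OF k z] by simp

end

text \<open>Let \<open>q\<close> be the parts above \<open>k\<close>. If \<open>q\<close> ends in \<open>k + 1\<close>, removing that part gives \<open>r\<close>;
  otherwise \<open>q\<close> lies above \<open>k + 1\<close> and lowering all its parts by one gives \<open>r\<close>. This \<open>r\<close> is
  empty only if \<open>q\<close> is \<open>[]\<close> or \<open>[k + 1]\<close>, and then the surplus is the number of parts.\<close>

lemma negative_surplus_cases:
  assumes k: "k \<ge> 2" and p: "p \<in> perimeter_partitions (S_minus k) n" and neg: "surplus k p < 0"
  obtains r z where "r \<noteq> []" "\<forall>x\<in>set r. k < x" "set z \<subseteq> {k - 1}"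
    "p = r @ (k + 1) # z \<or> p = map Suc r @ z"
proof -
  define q where "q = filter (\<lambda>x. k < x) p"
  define z where "z = filter (\<lambda>x. x \<le> k) p"
  have sorted: "sorted_wrt (\<ge>) p" and allowed: "\<forall>x\<in>set p. x = k - 1 \<or> k < x"
    using p notin_S_minus_iff[OF k] by (auto simp: perimeter_partitions_def is_partition_def)
  have p_eq: "p = q @ z"
    using sorted_wrt_ge_eq_filter_append[OF sorted] by (simp add: q_def z_def)
  have z: "set z \<subseteq> {k - 1}"
    using allowed by (auto simp: z_def)
  have q: "\<forall>x\<in>set q. k < x" and sorted_q: "sorted_wrt (\<ge>) q"
    using sorted by (auto simp: q_def intro: sorted_wrt_filter)
  have neg_q: "surplus k q < 0"
    using neg surplus_smallest_parts[OF k z] by (simp add: p_eq)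
  then have "q \<noteq> []"
    by auto
  show thesis
  proof (cases "last q = k + 1")
    case True
    with \<open>q \<noteq> []\<close> have q_eq: "q = butlast q @ [k + 1]"
      by (metis append_butlast_last_id)
    have "butlast q \<noteq> []"
    proof
      assume "butlast q = []"
      then have "q = [k + 1]"
        using q_eq by simp
      with neg_q show False
        by simp
    qed
    moreover have "\<forall>x\<in>set (butlast q). k < x"
      using q by (auto dest: in_set_butlastD)
    moreover have "p = butlast q @ (k + 1) # z"
      using p_eq q_eq by (metis append.assoc append_Cons append_Nil)
    ultimately show thesis
      using that z by blast
  next
    case False
    have "k + 1 < x" if "x \<in> set q" for x
    proof -
      have "last q \<le> x"
        using sorted_q that append_butlast_last_id[OF \<open>q \<noteq> []\<close>]
        by (metis (no_types, lifting) Un_iff list.set_intros(1) order_refl set_ConsD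
            set_append sorted_wrt_append empty_iff list.set(1))
      moreover have "k < last q"
        using q \<open>q \<noteq> []\<close> by simp
      ultimately show ?thesis
        using False by linarith
    qed
    then have "map Suc (map (\<lambda>x. x - 1) q) = q" "\<forall>x\<in>set (map (\<lambda>x. x - 1) q). k < x"
      by (force intro: map_idI)+
    with \<open>q \<noteq> []\<close> z p_eq show thesis
      using that[of "map (\<lambda>x. x - 1) q" z] by simp
  qed
qed

text \<open>Both members of a pair have a part above \<open>k\<close>; this is what keeps the partition into parts
  \<open>k - 1\<close> out of the image of \<open>toggle\<close>.\<close>

lemma toggle_negative_surplus:
  assumes k: "k \<ge> 2" and p: "p \<in> perimeter_partitions (S_minus k) n" and neg: "surplus k p < 0"
  shows "toggle k p \<in> perimeter_partitions (S_minus k) n"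
    and "surplus k (toggle k p) > 0"
    and "toggle k (toggle k p) = p"
    and "\<exists>x\<in>set (toggle k p). k < x"
proof -
  obtain r z where rz: "r \<noteq> []" "\<forall>x\<in>set r. k < x" "set z \<subseteq> {k - 1}"
    and p_eq: "p = r @ (k + 1) # z \<or> p = map Suc r @ z"
    using negative_surplus_cases[OF assms] .
  note toggle = toggle_with_Suc_k[OF k rz] toggle_without_Suc_k[OF k rz]
  show "toggle k p \<in> perimeter_partitions (S_minus k) n"
    using p_eq p perimeter_partitions_pair[OF k rz, of n] toggle by metis
  show "surplus k (toggle k p) > 0"
    using p_eq neg surplus_pair_pos[OF k rz] unfolding toggle by (elim disjE) (simp_all only: toggle)
  show "toggle k (toggle k p) = p"
    using p_eq toggle by metis
  obtain x where "x \<in> set r"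
    using rz(1) by (meson last_in_set)
  with rz(2) have "\<exists>x\<in>set (map Suc r @ z). k < x"
    by (intro bexI[of _ "Suc x"]) auto
  moreover have "\<exists>x\<in>set (r @ (k + 1) # z). k < x"
    by auto
  ultimately show "\<exists>x\<in>set (toggle k p). k < x"
    using p_eq toggle by metis
qed

section \<open>Comparing the cardinalities\<close>

lemma replicate_in_perimeter_partitions:
  assumes "k \<ge> 2" and "n \<ge> k - 1"
  shows "replicate (n + 2 - k) (k - 1) \<in> perimeter_partitions (S_minus k) n"
  using assms notin_S_minus_iff[of k "k - 1"]
  by (auto simp: perimeter_partitions_def is_partition_def perimeter_def sorted_wrt_iff_nth_less)

lemma card_negative_less_card_positive_surplus:
  assumes k: "k \<ge> 2" and n: "n \<ge> k - 1"
  shows "card {p \<in> perimeter_partitions (S_minus k) n. surplus k p < 0} <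
         card {p \<in> perimeter_partitions (S_minus k) n. surplus k p > 0}" (is "card ?N < card ?P")
proof -
  let ?c = "replicate (n + 2 - k) (k - 1)"
  have "?c \<in> ?P"
    using replicate_in_perimeter_partitions[OF assms] surplus_smallest_parts[of k ?c] k n
    by (auto simp: set_replicate_conv_if)
  moreover have "?c \<notin> toggle k ` ?N"
  proof
    assume "?c \<in> toggle k ` ?N"
    then have "\<exists>x\<in>set ?c. k < x"
      using toggle_negative_surplus(4)[OF k] by fastforce
    then show False
      by auto
  qed
  moreover have "toggle k ` ?N \<subseteq> ?P"
    using toggle_negative_surplus(1,2)[OF k] by blast
  ultimately have "toggle k ` ?N \<subset> ?P"
    by blast
  then have "card (toggle k ` ?N) < card ?P"
    by (intro psubset_card_mono) (simp_all add: finite_perimeter_partitions)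
  moreover have "inj_on (toggle k) ?N"
    by (rule inj_on_inverseI[of _ "toggle k"]) (use toggle_negative_surplus(3)[OF k] in blast)
  ultimately show ?thesis
    by (simp add: card_image)
qed

lemma perimeter_partitions_eq_empty:
  assumes "k \<ge> 2" and "n \<le> k - 2"
  shows "perimeter_partitions (S_minus k) n = {}"
proof (rule equals0I)
  fix p assume p: "p \<in> perimeter_partitions (S_minus k) n"
  then have "p \<noteq> []" and n: "Max (set p) + length p - 1 = n"
    by (auto simp: perimeter_partitions_def is_partition_def perimeter_def)
  then have "Max (set p) \<in> set p"
    by simp
  with p have "Max (set p) \<notin> S_minus k" "0 < Max (set p)"
    unfolding perimeter_partitions_def is_partition_def by blast+
  then have "Max (set p) \<ge> k - 1"
    using notin_S_minus_iff[OF assms(1)] by force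
  moreover have "length p > 0"
    using \<open>p \<noteq> []\<close> by simp
  ultimately show False
    using n assms by linarith
qed

theorem theorem1p2:
  fixes k n :: nat
  assumes "k \<ge> 2" and "n > 0"
  shows "(n \<ge> k - 1 \<longrightarrow>
            (even k \<longrightarrow> r_odd (S_minus k) n > r_even (S_minus k) n) \<and>
            (odd k \<longrightarrow> r_even (S_minus k) n > r_odd (S_minus k) n)) \<and>
         (n \<le> k - 2 \<longrightarrow> r_odd (S_minus k) n = r_even (S_minus k) n)"
proof (intro conjI impI)
  assume "n \<ge> k - 1" and "even k"
  then show "r_odd (S_minus k) n > r_even (S_minus k) n"
    using card_negative_less_card_positive_surplus[OF assms(1), of n]
    by (simp add: r_odd_def r_even_def surplus_eq)
next
  assume "n \<ge> k - 1" and "odd k"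
  then show "r_even (S_minus k) n > r_odd (S_minus k) n"
    using card_negative_less_card_positive_surplus[OF assms(1), of n]
    by (simp add: r_odd_def r_even_def surplus_eq)
next
  assume "n \<le> k - 2"
  then show "r_odd (S_minus k) n = r_even (S_minus k) n"
    using perimeter_partitions_eq_empty[OF assms(1), of n]
    by (simp add: r_odd_def r_even_def)
qed

end
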